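(* Let $X_1,\dots,X_k$ be commuting (classically) independent random variables having moments of all orders, and for each $i$ let $(R^{(i)}_n)_{n\ge1}$ be the free cumulants of $X_i$. Then for every $n\ge1$ the $n$th free cumulant $R_n$ of the product $X_1X_2\cdots X_k$ is given by $$R_n=\sum_{\substack{(\pi_1,\dots,\pi_k)\in NC(n)^k\\ \pi_1\vee\cdots\vee\pi_k=\mathbf{1}_n}}\ \prod_{i=1}^k R^{(i)}_{\pi_i},$$ the sum being over all $k$-tuples of noncrossing partitions of $\{1,\dots,n\}$ whose join is the one-block partition.
   Context: A set partition of $\{1,\dots,n\}$ is noncrossing if there are no $1\le a<b<c<d\le n$ with $a,c$ in one block and $b,d$ in a different block. $NC(n)$ denotes the set of noncrossing partitions of $\{1,\dots,n\}$, ordered by reverse refinement ($\pi\le\pi'$ iff every block of $\pi$ is contained in a block of $\pi'$); it is a lattice with largest element $\mathbf{1}_n$ (one block) and smallest element $\mathbf{0}_n$ (all singletons), and $\vee$ denotes the join in this lattice. For a sequence $(T_l)_{l\ge1}$ and $\pi\in NC(n)$, $T_\pi=\prod_{p\in\pi}T_{|p|}$, the product over blocks $p$ of $\pi$. If $(M_n)_{n\ge1}$ is the moment sequence of a random variable ($M_n=\mathbb E[X^n]$), its free cumulants $(R_n)_{n\ge1}$ are the unique numbers with $M_n=\sum_{\pi\in NC(n)}R_\pi$ for all $n\ge1$. *)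

theory Defs
  imports "HOL-Probability.Probability" "HOL-Algebra.Complete_Lattice"
begin

definition noncrossing :: "nat set set \<Rightarrow> bool" where
  "noncrossing \<pi> \<longleftrightarrow>
     \<not> (\<exists>p\<in>\<pi>. \<exists>q\<in>\<pi>. p \<noteq> q \<and>
          (\<exists>a b c d. a < b \<and> b < c \<and> c < d \<and> a \<in> p \<and> c \<in> p \<and> b \<in> q \<and> d \<in> q))"

definition NC :: "nat \<Rightarrow> nat set set set" where
  "NC n = {\<pi>. partition_on {1..n} \<pi> \<and> noncrossing \<pi>}"

definition NC_lattice :: "nat \<Rightarrow> nat set set gorder" where
  "NC_lattice n = \<lparr>carrier = NC n, eq = (=), le = refines {1..n}\<rparr>"

lemma finite_NC: "finite (NC n)"
  by (rule finite_subset[OF _ finitely_many_partition_on[of "{1..n}"]]) (auto simp: NC_def)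

lemma one_block_in_NC: "n \<ge> 1 \<Longrightarrow> {{1..n}} \<in> NC n"
  by (auto simp: NC_def partition_on_def noncrossing_def)

lemma common_refinement_in_NC:
  assumes "A \<subseteq> NC n" "A \<noteq> {}"
  shows "common_refinement A \<in> NC n"
proof -
  have part: "\<And>\<pi>. \<pi> \<in> A \<Longrightarrow> partition_on {1..n} \<pi>"
    using assms by (auto simp: NC_def)
  have cpart: "partition_on {1..n} (common_refinement A)"
    by (rule partition_on_common_refinement) (use part assms in auto)
  have "noncrossing (common_refinement A)"
    unfolding noncrossing_def
  proof (safe)
    fix p q a b c d
    assume pq: "p \<in> common_refinement A" "q \<in> common_refinement A"
      and lt: "a < b" "b < c" "c < d"
      and mem: "a \<in> p" "c \<in> p" "b \<in> q" "d \<in> q"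
    obtain f where f: "\<And>\<pi>. \<pi> \<in> A \<Longrightarrow> f \<pi> \<in> \<pi>" "p = \<Inter>(f ` A)"
      using pq(1) by (auto simp: common_refinement)
    obtain g where g: "\<And>\<pi>. \<pi> \<in> A \<Longrightarrow> g \<pi> \<in> \<pi>" "q = \<Inter>(g ` A)"
      using pq(2) by (auto simp: common_refinement)
    have eq: "f \<pi> = g \<pi>" if "\<pi> \<in> A" for \<pi>
    proof (rule ccontr)
      assume ne: "f \<pi> \<noteq> g \<pi>"
      have "noncrossing \<pi>"
        using that assms by (auto simp: NC_def)
      moreover have "a \<in> f \<pi>" "c \<in> f \<pi>" "b \<in> g \<pi>" "d \<in> g \<pi>"
        using mem f(2) g(2) that by auto
      ultimately show False
        using ne f(1)[OF that] g(1)[OF that] lt unfolding noncrossing_def by blast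
    qed
    have "p = q"
      using f(2) g(2) eq by auto
    then show "x \<in> q" if "x \<in> p" for x using that by simp
    show "x \<in> p" if "x \<in> q" for x using that \<open>p = q\<close> by simp
  qed
  then show ?thesis
    using cpart by (simp add: NC_def)
qed

lemma NC_complete_lattice:
  assumes "n \<ge> 1"
  shows "complete_lattice (NC_lattice n)"
proof -
  interpret partial_order "NC_lattice n"
  proof
    show "\<pi> \<sqsubseteq>\<^bsub>NC_lattice n\<^esub> \<pi>" if "\<pi> \<in> carrier (NC_lattice n)" for \<pi>
      using that by (simp add: NC_lattice_def NC_def refines_refl)
    show "\<pi> .=\<^bsub>NC_lattice n\<^esub> \<tau>" if "\<pi> \<sqsubseteq>\<^bsub>NC_lattice n\<^esub> \<tau>" "\<tau> \<sqsubseteq>\<^bsub>NC_lattice n\<^esub> \<pi>" for \<pi> \<tau>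
      using that refines_asym[of "{1..n}" \<pi> \<tau>] by (simp add: NC_lattice_def)
    show "\<pi> \<sqsubseteq>\<^bsub>NC_lattice n\<^esub> \<rho>" if "\<pi> \<sqsubseteq>\<^bsub>NC_lattice n\<^esub> \<tau>" "\<tau> \<sqsubseteq>\<^bsub>NC_lattice n\<^esub> \<rho>" for \<pi> \<tau> \<rho>
      using that refines_trans[of "{1..n}" \<pi> \<tau> \<rho>] by (simp add: NC_lattice_def)
  qed (simp_all add: NC_lattice_def)
  show ?thesis
  proof (rule complete_lattice_criterion1)
    have "refines {1..n} \<pi> {{1..n}}" if "\<pi> \<in> NC n" for \<pi>
      using that one_block_in_NC[OF assms] unfolding refines_def NC_def partition_on_def
      by blast
    then show "\<exists>g. greatest (NC_lattice n) g (carrier (NC_lattice n))"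
      using one_block_in_NC[OF assms]
      by (intro exI[of _ "{{1..n}}"]) (auto simp: greatest_def NC_lattice_def)
  next
    fix A assume A: "A \<subseteq> carrier (NC_lattice n)" "A \<noteq> {}"
    then have A': "A \<subseteq> NC n" by (simp add: NC_lattice_def)
    then have part: "\<And>\<pi>. \<pi> \<in> A \<Longrightarrow> partition_on {1..n} \<pi>"
      by (auto simp: NC_def)
    have "greatest (NC_lattice n) (common_refinement A) (Lower (NC_lattice n) A)"
    proof (rule greatest_LowerI)
      show "common_refinement A \<sqsubseteq>\<^bsub>NC_lattice n\<^esub> \<pi>" if "\<pi> \<in> A" for \<pi>
        using refines_common_refinement[of A "{1..n}" \<pi>] part that by (simp add: NC_lattice_def)
      show "\<tau> \<sqsubseteq>\<^bsub>NC_lattice n\<^esub> common_refinement A" if "\<tau> \<in> Lower (NC_lattice n) A" for \<tau>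
        using that common_refinement_coarsest[of A "{1..n}" \<tau>] part A A'
        by (auto simp: NC_lattice_def Lower_def NC_def)
      show "A \<subseteq> carrier (NC_lattice n)" by (rule A)
      show "common_refinement A \<in> carrier (NC_lattice n)"
        using common_refinement_in_NC[OF A' A(2)] by (simp add: NC_lattice_def)
    qed
    then show "\<exists>i. greatest (NC_lattice n) i (Lower (NC_lattice n) A)" ..
  qed
qed

definition block_prod :: "(nat \<Rightarrow> 'a::comm_monoid_mult) \<Rightarrow> nat set set \<Rightarrow> 'a" where
  "block_prod T \<pi> = (\<Prod>p\<in>\<pi>. T (card p))"

text \<open>Sequences indexed by \<open>n \<ge> 1\<close> are functions on \<^typ>\<open>nat\<close>; the value of a free cumulant
  sequence at \<open>0\<close>, which never occurs in a \<^const>\<open>block_prod\<close> over a partition, is fixed to be \<open>0\<close>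
  so that the sequence is unique.\<close>

definition free_cumulants :: "(nat \<Rightarrow> 'a::comm_ring_1) \<Rightarrow> nat \<Rightarrow> 'a" where
  "free_cumulants m = (THE R. R 0 = 0 \<and> (\<forall>n\<ge>1. m n = (\<Sum>\<pi>\<in>NC n. block_prod R \<pi>)))"

lemma card_block_less:
  assumes "\<pi> \<in> NC n" "\<pi> \<noteq> {{1..n}}" "p \<in> \<pi>"
  shows "1 \<le> card p" "card p < n"
proof -
  have part: "partition_on {1..n} \<pi>" using assms by (simp add: NC_def)
  have sub: "p \<subseteq> {1..n}" and ne: "p \<noteq> {}"
    using part assms by (auto simp: partition_on_def)
  have fin: "finite p" using sub finite_subset by blast
  show "1 \<le> card p" using fin ne by (simp add: Suc_le_eq card_gt_0_iff)
  have "p \<noteq> {1..n}"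
  proof
    assume p: "p = {1..n}"
    have "q = p" if "q \<in> \<pi>" for q
    proof (rule ccontr)
      assume "q \<noteq> p"
      then have "q \<inter> p = {}"
        using part that assms(3) by (auto simp: partition_on_def disjoint_def)
      moreover have "q \<subseteq> p" "q \<noteq> {}"
        using part that p by (auto simp: partition_on_def)
      ultimately show False by blast
    qed
    then have "\<pi> = {p}" using assms(3) by blast
    then have "\<pi> = {{1..n}}" by (simp only: p)
    then show False using assms(2) by simp
  qed
  then have "p \<subset> {1..n}" using sub by blast
  then show "card p < n" using psubset_card_mono[of "{1..n}" p] by simp
qed

lemma sum_block_prod_NC:
  fixes R :: "nat \<Rightarrow> 'a::comm_ring_1"
  assumes "n \<ge> 1"
  shows "(\<Sum>\<pi>\<in>NC n. block_prod R \<pi>) = R n + (\<Sum>\<pi>\<in>NC n - {{{1..n}}}. block_prod R \<pi>)"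
  using one_block_in_NC[OF assms] finite_NC[of n]
  by (subst sum.remove[of _ "{{1..n}}"]) (auto simp: block_prod_def)

lemma sum_proper_cong:
  assumes "\<And>l. 1 \<le> l \<Longrightarrow> l < n \<Longrightarrow> R l = S l"
  shows "(\<Sum>\<pi>\<in>NC n - {{{1..n}}}. block_prod R \<pi>) = (\<Sum>\<pi>\<in>NC n - {{{1..n}}}. block_prod S \<pi>)"
  unfolding block_prod_def
  by (intro sum.cong prod.cong refl assms) (auto dest: card_block_less)

lemma free_cumulants_ex1:
  fixes m :: "nat \<Rightarrow> 'a::comm_ring_1"
  shows "\<exists>!R. R 0 = 0 \<and> (\<forall>n\<ge>1. m n = (\<Sum>\<pi>\<in>NC n. block_prod R \<pi>))"
proof (rule ex_ex1I)
  define R where "R = wfrec less_than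
    (\<lambda>f n. if n = 0 then 0 else m n - (\<Sum>\<pi>\<in>NC n - {{{1..n}}}. block_prod f \<pi>))"
  have R: "R n = (if n = 0 then 0 else m n - (\<Sum>\<pi>\<in>NC n - {{{1..n}}}. block_prod R \<pi>))" for n
  proof -
    have "R n = (if n = 0 then 0 else
        m n - (\<Sum>\<pi>\<in>NC n - {{{1..n}}}. block_prod (cut R less_than n) \<pi>))"
      unfolding R_def by (subst wfrec[OF wf_less_than]) simp
    also have "(\<Sum>\<pi>\<in>NC n - {{{1..n}}}. block_prod (cut R less_than n) \<pi>)
        = (\<Sum>\<pi>\<in>NC n - {{{1..n}}}. block_prod R \<pi>)"
      by (rule sum_proper_cong) (simp add: cut_apply)
    finally show ?thesis .
  qed
  have "m n = (\<Sum>\<pi>\<in>NC n. block_prod R \<pi>)" if "n \<ge> 1" for n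
    using sum_block_prod_NC[OF that, of R] R[of n] that by simp
  then show "\<exists>R. R 0 = 0 \<and> (\<forall>n\<ge>1. m n = (\<Sum>\<pi>\<in>NC n. block_prod R \<pi>))"
    using R[of 0] by auto
next
  fix R S :: "nat \<Rightarrow> 'a"
  assume R: "R 0 = 0 \<and> (\<forall>n\<ge>1. m n = (\<Sum>\<pi>\<in>NC n. block_prod R \<pi>))"
    and S: "S 0 = 0 \<and> (\<forall>n\<ge>1. m n = (\<Sum>\<pi>\<in>NC n. block_prod S \<pi>))"
  have "R n = S n" for n
  proof (induction n rule: less_induct)
    case (less n)
    show ?case
    proof (cases "n = 0")
      case False
      then have n: "n \<ge> 1" by simp
      have "(\<Sum>\<pi>\<in>NC n. block_prod R \<pi>) = (\<Sum>\<pi>\<in>NC n. block_prod S \<pi>)"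
        using R S n by metis
      then show ?thesis
        unfolding sum_block_prod_NC[OF n] using sum_proper_cong[of n R S] less by simp
    qed (use R S in simp)
  qed
  then show "R = S" by blast
qed

lemma moment_free_cumulants:
  fixes m :: "nat \<Rightarrow> 'a::comm_ring_1"
  assumes "n \<ge> 1"
  shows "m n = (\<Sum>\<pi>\<in>NC n. block_prod (free_cumulants m) \<pi>)"
  using theI'[OF free_cumulants_ex1[of m]] assms unfolding free_cumulants_def by blast

text \<open>Scalars range over the real Banach fields, that is, \<open>\<real>\<close> and \<open>\<complex>\<close>.\<close>

definition moment ::
    "'w measure \<Rightarrow> ('w \<Rightarrow> 'a::{real_normed_field, banach, second_countable_topology}) \<Rightarrow> nat \<Rightarrow> 'a"
  where "moment M X n = (\<integral>\<omega>. X \<omega> ^ n \<partial>M)"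

definition has_all_moments ::
    "'w measure \<Rightarrow> ('w \<Rightarrow> 'a::{real_normed_field, banach, second_countable_topology}) \<Rightarrow> bool"
  where "has_all_moments M X \<longleftrightarrow> (\<forall>n. integrable M (\<lambda>\<omega>. X \<omega> ^ n))"

end

theory Submission
  imports Defs
begin

text \<open>The identity is the top case of a statement about every noncrossing partition \<open>\<sigma>\<close>. Let \<open>G\<^sub>\<sigma>\<close> be
  the sum of the products of cumulants over the tuples with join \<open>\<sigma>\<close>, let \<open>R\<close> be the free cumulants
  of the product and \<open>M\<close> its moments. A tuple has join below \<open>\<sigma>\<close> iff all its entries are below \<open>\<sigma>\<close>, and
  the noncrossing partitions below \<open>\<sigma>\<close> restrict independently to its blocks, so the sum of \<open>G\<^sub>\<tau>\<close>
  over \<open>\<tau> \<le> \<sigma>\<close> factors over the variables and over the blocks. By independence it equals \<open>M\<^sub>\<sigma>\<close>, which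
  is the sum of \<open>R\<^sub>\<tau>\<close> over \<open>\<tau> \<le> \<sigma>\<close>. By Moebius inversion \<open>G\<^sub>\<sigma> = R\<^sub>\<sigma>\<close> for all \<open>\<sigma>\<close>.\<close>

section \<open>Noncrossing partitions of finite sets of naturals and increasing relabelings\<close>

text \<open>Blocks of a noncrossing partition need not be intervals, so partitioning a block calls
  for an arbitrary ground set.\<close>

definition NC_on :: "nat set \<Rightarrow> nat set set set" where
  "NC_on A = {\<pi>. partition_on A \<pi> \<and> noncrossing \<pi>}"

lemma NC_eq_NC_on: "NC n = NC_on {1..n}"
  by (simp add: NC_def NC_on_def)

lemma finite_NC_on: "finite A \<Longrightarrow> finite (NC_on A)"
  by (rule finite_subset[OF _ finitely_many_partition_on[of A]]) (auto simp: NC_on_def)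

lemma noncrossingI:
  assumes "\<And>p q a b c d. \<lbrakk>p \<in> \<pi>; q \<in> \<pi>; a < b; b < c; c < d; a \<in> p; c \<in> p; b \<in> q; d \<in> q\<rbrakk> \<Longrightarrow> p = q"
  shows "noncrossing \<pi>"
  unfolding noncrossing_def using assms by blast

lemma noncrossingD:
  "\<lbrakk>noncrossing \<pi>; p \<in> \<pi>; q \<in> \<pi>; a < b; b < c; c < d; a \<in> p; c \<in> p; b \<in> q; d \<in> q\<rbrakk> \<Longrightarrow> p = q"
  unfolding noncrossing_def by blast

text \<open>A strictly increasing map reflects the order, so a crossing of two image blocks pulls
  back to a crossing of the original blocks.\<close>

lemma noncrossing_image:
  assumes f: "strict_mono_on A f" and \<pi>: "\<Union>\<pi> \<subseteq> A" and nc: "noncrossing \<pi>"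
  shows "noncrossing ((`) f ` \<pi>)"
proof (rule noncrossingI)
  fix p' q' a b c d
  assume "p' \<in> (`) f ` \<pi>" "q' \<in> (`) f ` \<pi>" and lt: "a < b" "b < c" "c < d"
    and mem: "a \<in> p'" "c \<in> p'" "b \<in> q'" "d \<in> q'"
  then obtain p q where p: "p \<in> \<pi>" "p' = f ` p" and q: "q \<in> \<pi>" "q' = f ` q"
    by blast
  obtain a' b' c' d' where eq: "a = f a'" "b = f b'" "c = f c'" "d = f d'"
    and mem': "a' \<in> p" "c' \<in> p" "b' \<in> q" "d' \<in> q"
    using mem unfolding p q by blast
  have A: "a' \<in> A" "b' \<in> A" "c' \<in> A" "d' \<in> A"
    using mem' p q \<pi> by auto
  have "a' < b'" "b' < c'" "c' < d'"
    using lt A unfolding eq by (simp_all add: strict_mono_on_less[OF f])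
  then have "p = q"
    using noncrossingD[OF nc p(1) q(1)] mem' by blast
  then show "p' = q'"
    by (simp add: p q)
qed

lemma image_in_NC_on:
  assumes f: "strict_mono_on A f" and \<pi>: "\<pi> \<in> NC_on A"
  shows "(`) f ` \<pi> \<in> NC_on (f ` A)"
proof -
  have part: "partition_on A \<pi>" and nc: "noncrossing \<pi>"
    using \<pi> by (auto simp: NC_on_def)
  have "{} \<notin> (`) f ` \<pi>"
    using partition_onD3[OF part] by auto
  then have "partition_on (f ` A) ((`) f ` \<pi>)"
    using partition_on_inj_image[OF part strict_mono_on_imp_inj_on[OF f]] by simp
  then show ?thesis
    using noncrossing_image[OF f _ nc] partition_onD1[OF part] by (simp add: NC_on_def)
qed

lemma block_prod_image:
  assumes inj: "inj_on f A" and part: "partition_on A \<pi>"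
  shows "block_prod T ((`) f ` \<pi>) = block_prod T \<pi>"
proof -
  have sub: "p \<subseteq> A" if "p \<in> \<pi>" for p
    using that partition_onD1[OF part] by auto
  have "inj_on ((`) f) \<pi>"
    using inj_on_subset[OF inj_on_image_Pow[OF inj]] sub by blast
  then have "block_prod T ((`) f ` \<pi>) = (\<Prod>p\<in>\<pi>. T (card (f ` p)))"
    by (simp add: block_prod_def prod.reindex)
  also have "\<dots> = block_prod T \<pi>"
    unfolding block_prod_def
    by (intro prod.cong refl) (simp add: card_image inj_on_subset[OF inj sub])
  finally show ?thesis .
qed

text \<open>Relabeling along \<open>f\<close> and along its inverse are mutually inverse on
  noncrossing partitions, and both keep block sizes.\<close>

lemma sum_block_prod_NC_on_image:
  fixes T :: "nat \<Rightarrow> 'a::comm_semiring_1"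
  assumes f: "strict_mono_on A f"
  shows "(\<Sum>\<pi>\<in>NC_on (f ` A). block_prod T \<pi>) = (\<Sum>\<pi>\<in>NC_on A. block_prod T \<pi>)"
proof -
  have inj: "inj_on f A"
    by (rule strict_mono_on_imp_inj_on[OF f])
  define g where "g = the_inv_into A f"
  have gf: "g (f x) = x" if "x \<in> A" for x
    using that inj by (simp add: g_def the_inv_into_f_f)
  have gA: "g ` f ` A = A"
    by (simp add: image_image gf)
  have g: "strict_mono_on (f ` A) g"
    by (auto simp: strict_mono_on_def gf strict_mono_on_less[OF f])
  have gf_sets: "(`) g ` (`) f ` \<pi> = \<pi>" if "\<Union>\<pi> \<subseteq> A" for \<pi>
  proof -
    have "g ` f ` p = p" if "p \<in> \<pi>" for p
      using that \<open>\<Union>\<pi> \<subseteq> A\<close> gf by (force simp: image_image)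
    then show ?thesis
      by (simp add: image_image)
  qed
  have fg_sets: "(`) f ` (`) g ` \<pi> = \<pi>" if "\<Union>\<pi> \<subseteq> f ` A" for \<pi>
  proof -
    have "f ` g ` p = p" if "p \<in> \<pi>" for p
    proof -
      have "f (g y) = y" if "y \<in> p" for y
        using that \<open>p \<in> \<pi>\<close> \<open>\<Union>\<pi> \<subseteq> f ` A\<close> gf by force
      then show ?thesis
        by (simp add: image_image)
    qed
    then show ?thesis
      by (simp add: image_image)
  qed
  show ?thesis
  proof (rule sum.reindex_bij_witness[of _ "(`) ((`) f)" "(`) ((`) g)"])
    fix \<pi> assume \<pi>: "\<pi> \<in> NC_on (f ` A)"
    then have part: "partition_on (f ` A) \<pi>" by (simp add: NC_on_def)
    show "(`) f ` (`) g ` \<pi> = \<pi>"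
      using fg_sets partition_onD1[OF part] by simp
    show "(`) g ` \<pi> \<in> NC_on A"
      using image_in_NC_on[OF g \<pi>] by (simp add: gA)
    show "block_prod T ((`) g ` \<pi>) = block_prod T \<pi>"
      by (rule block_prod_image[OF strict_mono_on_imp_inj_on[OF g] part])
  next
    fix \<pi> assume \<pi>: "\<pi> \<in> NC_on A"
    then have part: "partition_on A \<pi>" by (simp add: NC_on_def)
    show "(`) g ` (`) f ` \<pi> = \<pi>"
      using gf_sets partition_onD1[OF part] by simp
    show "(`) f ` \<pi> \<in> NC_on (f ` A)"
      by (rule image_in_NC_on[OF f \<pi>])
  qed
qed

lemma sum_block_prod_NC_on:
  fixes T :: "nat \<Rightarrow> 'a::comm_semiring_1"
  assumes "finite A"
  shows "(\<Sum>\<pi>\<in>NC_on A. block_prod T \<pi>) = (\<Sum>\<pi>\<in>NC (card A). block_prod T \<pi>)"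
proof -
  obtain h where h: "bij_betw h {..<card A} A" "strict_mono_on {..<card A} h"
    using ex_bij_betw_strict_mono_card[OF assms] .
  \<comment> \<open>The increasing enumeration of \<open>A\<close> is indexed from 0, while
    \<open>NC\<close> partitions a set that starts at 1; \<open>Suc\<close> makes the shift.\<close>
  have Suc: "strict_mono_on {..<card A} Suc"
    by (simp add: strict_mono_on_def)
  have "(\<Sum>\<pi>\<in>NC_on A. block_prod T \<pi>) = (\<Sum>\<pi>\<in>NC_on {..<card A}. block_prod T \<pi>)"
    using sum_block_prod_NC_on_image[OF h(2)] bij_betw_imp_surj_on[OF h(1)] by simp
  also have "\<dots> = (\<Sum>\<pi>\<in>NC (card A). block_prod T \<pi>)"
    using sum_block_prod_NC_on_image[OF Suc, of T] by (simp add: NC_eq_NC_on image_Suc_lessThan)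
  finally show ?thesis .
qed

section \<open>Factorization over the blocks of \<sigma>\<close>

text \<open>Crossing blocks from two different blocks of \<sigma> would make these cross; inside one
  block of \<sigma>, the partition chosen by \<open>h\<close> is noncrossing.\<close>

lemma noncrossing_UN:
  assumes nc: "noncrossing \<sigma>" and h: "\<And>p. p \<in> \<sigma> \<Longrightarrow> h p \<in> NC_on p"
  shows "noncrossing (\<Union>p\<in>\<sigma>. h p)"
proof (rule noncrossingI)
  fix p q a b c d
  assume "p \<in> (\<Union>p\<in>\<sigma>. h p)" "q \<in> (\<Union>p\<in>\<sigma>. h p)"
    and lt: "a < b" "b < c" "c < d" and mem: "a \<in> p" "c \<in> p" "b \<in> q" "d \<in> q"
  then obtain P Q where P: "P \<in> \<sigma>" "p \<in> h P" and Q: "Q \<in> \<sigma>" "q \<in> h Q"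
    by blast
  have "p \<subseteq> P" "q \<subseteq> Q"
    using h P Q by (auto simp: NC_on_def dest: partition_onD1)
  then have "P = Q"
    using noncrossingD[OF nc P(1) Q(1) lt] mem by blast
  moreover have "noncrossing (h Q)"
    using h[OF Q(1)] by (simp add: NC_on_def)
  ultimately show "p = q"
    using noncrossingD[OF _ _ _ lt] P Q mem by blast
qed

text \<open>A noncrossing partition below \<sigma> amounts to an independent choice of a noncrossing
  partition of each block of \<sigma>. Weights multiply under gluing, so the sum distributes, and
  only the size of each block matters.\<close>

lemma sum_block_prod_refines:
  fixes T :: "nat \<Rightarrow> 'a::comm_ring_1"
  assumes \<sigma>: "\<sigma> \<in> NC n"
  shows "(\<Sum>\<pi> | \<pi> \<in> NC n \<and> refines {1..n} \<pi> \<sigma>. block_prod T \<pi>) =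
    (\<Prod>p\<in>\<sigma>. \<Sum>\<pi>\<in>NC (card p). block_prod T \<pi>)"
proof -
  have part: "partition_on {1..n} \<sigma>" and nc: "noncrossing \<sigma>"
    using \<sigma> by (auto simp: NC_def)
  have fin: "finite \<sigma>"
    using finite_elements[OF _ part] by simp
  have finp: "finite p" if "p \<in> \<sigma>" for p
    using that partition_onD1[OF part] by (metis Union_upper finite_atLeastAtMost finite_subset)
  have disj: "P \<inter> Q = {}" if "P \<in> \<sigma>" "Q \<in> \<sigma>" "P \<noteq> Q" for P Q
    using that partition_onD2[OF part] by (auto simp: disjoint_def)
  \<comment> \<open>Gluing a choice \<open>h\<close>: the union lies below \<sigma>, and
    \<open>h P\<close> is recovered from it as the set of blocks inside \<open>P\<close>.\<close>
  have UN: "partition_on {1..n} (\<Union>p\<in>\<sigma>. h p)" "refines {1..n} (\<Union>p\<in>\<sigma>. h p) \<sigma>"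
    and restrict_UN: "\<And>P. P \<in> \<sigma> \<Longrightarrow> {q \<in> (\<Union>p\<in>\<sigma>. h p). q \<subseteq> P} = h P"
    and block_prod_UN: "block_prod T (\<Union>p\<in>\<sigma>. h p) = (\<Prod>p\<in>\<sigma>. block_prod T (h p))"
    if h: "\<And>p. p \<in> \<sigma> \<Longrightarrow> h p \<in> NC_on p" for h
  proof -
    have hp: "\<Union>(h p) = p" "disjoint (h p)" "{} \<notin> h p" if "p \<in> \<sigma>" for p
      using h[OF that] by (auto simp: NC_on_def partition_on_def)
    have sub: "q \<subseteq> P" "q \<noteq> {}" if "q \<in> h P" "P \<in> \<sigma>" for q P
      using hp[OF that(2)] that by auto
    show *: "partition_on {1..n} (\<Union>p\<in>\<sigma>. h p)"
    proof (rule partition_onI)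
      have "\<Union>(\<Union>p\<in>\<sigma>. h p) = (\<Union>p\<in>\<sigma>. \<Union>(h p))"
        by blast
      also have "\<dots> = {1..n}"
        using hp(1) partition_onD1[OF part] by simp
      finally show "\<Union>(\<Union>p\<in>\<sigma>. h p) = {1..n}" .
      show "{} \<notin> (\<Union>p\<in>\<sigma>. h p)"
        using hp(3) by auto
      fix p q assume "p \<in> (\<Union>p\<in>\<sigma>. h p)" "q \<in> (\<Union>p\<in>\<sigma>. h p)" "p \<noteq> q"
      then obtain P Q where PQ: "P \<in> \<sigma>" "Q \<in> \<sigma>" "p \<in> h P" "q \<in> h Q" by blast
      show "disjnt p q"
      proof (cases "P = Q")
        case True
        then show ?thesis
          using hp(2)[OF PQ(1)] PQ \<open>p \<noteq> q\<close> by (auto simp: disjoint_def disjnt_def)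
      next
        case False
        then show ?thesis
          using disj[OF PQ(1,2)] sub[OF PQ(3,1)] sub[OF PQ(4,2)] by (auto simp: disjnt_def)
      qed
    qed
    show "refines {1..n} (\<Union>p\<in>\<sigma>. h p) \<sigma>"
      unfolding refines_def using * part sub by blast
    \<comment> \<open>A nonempty block inside both \<open>P\<close> and \<open>Q\<close> forces
      \<open>P = Q\<close>, since blocks of \<sigma> are disjoint.\<close>
    have inP: "q \<in> h P" if "q \<in> h Q" "Q \<in> \<sigma>" "P \<in> \<sigma>" "q \<subseteq> P" for q P Q
      using that sub[of q Q] disj[of P Q] by blast
    show "{q \<in> (\<Union>p\<in>\<sigma>. h p). q \<subseteq> P} = h P" if "P \<in> \<sigma>" for P
      using that sub inP by blast
    have "finite (h p)" if "p \<in> \<sigma>" for p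
      using h[OF that] finite_elements[OF finp[OF that]] by (simp add: NC_on_def)
    moreover have "h P \<inter> h Q = {}" if "P \<in> \<sigma>" "Q \<in> \<sigma>" "P \<noteq> Q" for P Q
    proof (rule equals0I)
      fix q assume "q \<in> h P \<inter> h Q"
      then have "q \<subseteq> P" "q \<subseteq> Q" "q \<noteq> {}"
        using sub that(1,2) by auto
      then show False
        using disj[OF that] by blast
    qed
    ultimately show "block_prod T (\<Union>p\<in>\<sigma>. h p) = (\<Prod>p\<in>\<sigma>. block_prod T (h p))"
      unfolding block_prod_def by (intro prod.UNION_disjoint fin) auto
  qed
  \<comment> \<open>By refinement the blocks of \<pi> inside \<open>p\<close> cover
    \<open>p\<close>; a subfamily of a noncrossing family is noncrossing.\<close>
  have restrict: "{q \<in> \<pi>. q \<subseteq> p} \<in> NC_on p"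
    if "noncrossing \<pi>" "refines {1..n} \<pi> \<sigma>" "p \<in> \<sigma>" for \<pi> p
    using refines_obtains_subset[OF that(2,3)] that(1)
    unfolding NC_on_def noncrossing_def by blast
  have UN_restrict: "(\<Union>p\<in>\<sigma>. {q \<in> \<pi>. q \<subseteq> p}) = \<pi>" if "refines {1..n} \<pi> \<sigma>" for \<pi>
    using that unfolding refines_def by blast
  have "(\<Sum>\<pi> | \<pi> \<in> NC n \<and> refines {1..n} \<pi> \<sigma>. block_prod T \<pi>) =
      (\<Sum>h\<in>Pi\<^sub>E \<sigma> NC_on. \<Prod>p\<in>\<sigma>. block_prod T (h p))"
  \<comment> \<open>Elements of \<open>Pi\<^sub>E\<close> are \<open>undefined\<close> off \<sigma>,
    so the family of restrictions is cut off by a bounded abstraction to be an exact inverse of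
    gluing.\<close>
  proof (rule sum.reindex_bij_witness[of _ "\<lambda>h. \<Union>p\<in>\<sigma>. h p" "\<lambda>\<pi>. \<lambda>p\<in>\<sigma>. {q \<in> \<pi>. q \<subseteq> p}"])
    fix \<pi> assume "\<pi> \<in> {\<pi> \<in> NC n. refines {1..n} \<pi> \<sigma>}"
    then have \<pi>: "noncrossing \<pi>" "refines {1..n} \<pi> \<sigma>" by (auto simp: NC_def)
    show "(\<Union>p\<in>\<sigma>. (\<lambda>p\<in>\<sigma>. {q \<in> \<pi>. q \<subseteq> p}) p) = \<pi>"
      using UN_restrict[OF \<pi>(2)] by simp
    show r: "(\<lambda>p\<in>\<sigma>. {q \<in> \<pi>. q \<subseteq> p}) \<in> Pi\<^sub>E \<sigma> NC_on"
      using restrict[OF \<pi>] by (simp add: restrict_PiE_iff)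
    show "(\<Prod>p\<in>\<sigma>. block_prod T ((\<lambda>p\<in>\<sigma>. {q \<in> \<pi>. q \<subseteq> p}) p)) = block_prod T \<pi>"
      using block_prod_UN[of "\<lambda>p. {q \<in> \<pi>. q \<subseteq> p}"] restrict[OF \<pi>] UN_restrict[OF \<pi>(2)] by simp
  next
    fix h assume h: "h \<in> Pi\<^sub>E \<sigma> NC_on"
    then have h': "h p \<in> NC_on p" if "p \<in> \<sigma>" for p using that by (rule PiE_mem)
    show "(\<Union>p\<in>\<sigma>. h p) \<in> {\<pi> \<in> NC n. refines {1..n} \<pi> \<sigma>}"
      using UN[OF h'] noncrossing_UN[OF nc h'] by (simp add: NC_def)
    show "(\<lambda>P\<in>\<sigma>. {q \<in> (\<Union>p\<in>\<sigma>. h p). q \<subseteq> P}) = h"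
    proof
      fix P
      show "(\<lambda>P\<in>\<sigma>. {q \<in> (\<Union>p\<in>\<sigma>. h p). q \<subseteq> P}) P = h P"
        using restrict_UN[OF h', of P] PiE_arb[OF h, of P] by (cases "P \<in> \<sigma>") simp_all
    qed
  qed
  also have "\<dots> = (\<Prod>p\<in>\<sigma>. \<Sum>\<pi>\<in>NC_on p. block_prod T \<pi>)"
    by (rule prod_sum_PiE[symmetric]) (use fin finp finite_NC_on in auto)
  also have "\<dots> = (\<Prod>p\<in>\<sigma>. \<Sum>\<pi>\<in>NC (card p). block_prod T \<pi>)"
    by (intro prod.cong refl sum_block_prod_NC_on finp)
  finally show ?thesis .
qed

lemma sum_refines_free_cumulants:
  fixes m :: "nat \<Rightarrow> 'a::comm_ring_1"
  assumes \<sigma>: "\<sigma> \<in> NC n"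
  shows "(\<Sum>\<pi> | \<pi> \<in> NC n \<and> refines {1..n} \<pi> \<sigma>. block_prod (free_cumulants m) \<pi>) = block_prod m \<sigma>"
proof -
  have "m (card p) = (\<Sum>\<pi>\<in>NC (card p). block_prod (free_cumulants m) \<pi>)" if "p \<in> \<sigma>" for p
  proof (rule moment_free_cumulants)
    \<comment> \<open>The moment-cumulant relation starts at index 1, so blocks have to be
      nonempty.\<close>
    have "p \<subseteq> {1..n}" "p \<noteq> {}"
      using \<sigma> that by (auto simp: NC_def partition_on_def)
    then show "1 \<le> card p"
      using finite_subset by (fastforce simp: Suc_le_eq card_gt_0_iff)
  qed
  then show ?thesis
    unfolding sum_block_prod_refines[OF \<sigma>] by (simp add: block_prod_def)
qed

section \<open>Inversion over the refinement order and joins\<close>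

text \<open>Moebius inversion without the Moebius function: by induction on the size of the
  down-set, all terms strictly below \<sigma> agree, so equal sums leave equal terms at
  \<sigma>.\<close>

lemma NC_sum_refines_inject:
  fixes f g :: "nat set set \<Rightarrow> 'a::ab_group_add"
  assumes eq: "\<And>\<sigma>. \<sigma> \<in> NC n \<Longrightarrow>
      (\<Sum>\<tau> | \<tau> \<in> NC n \<and> refines {1..n} \<tau> \<sigma>. f \<tau>) = (\<Sum>\<tau> | \<tau> \<in> NC n \<and> refines {1..n} \<tau> \<sigma>. g \<tau>)"
    and "\<sigma> \<in> NC n"
  shows "f \<sigma> = g \<sigma>"
  using \<open>\<sigma> \<in> NC n\<close>
proof (induction "card {\<tau> \<in> NC n. refines {1..n} \<tau> \<sigma>}" arbitrary: \<sigma> rule: less_induct)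
  case less
  let ?D = "\<lambda>\<sigma>. {\<tau> \<in> NC n. refines {1..n} \<tau> \<sigma>}"
  have fin: "finite (?D \<sigma>)" for \<sigma>
    using finite_NC[of n] by simp
  have self: "\<sigma> \<in> ?D \<sigma>"
    using less.prems by (auto simp: NC_def refines_refl)
  have "f \<tau> = g \<tau>" if \<tau>: "\<tau> \<in> ?D \<sigma> - {\<sigma>}" for \<tau>
  proof (rule less.hyps)
    \<comment> \<open>Transitivity gives the inclusion; antisymmetry makes it strict, as \<sigma>
      itself is missing on the left.\<close>
    have "?D \<tau> \<subseteq> ?D \<sigma>"
      using \<tau> refines_trans by blast
    moreover have "\<sigma> \<notin> ?D \<tau>"
      using \<tau> refines_asym by blast
    ultimately show "card (?D \<tau>) < card (?D \<sigma>)"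
      using self fin by (intro psubset_card_mono) blast+
    show "\<tau> \<in> NC n" using \<tau> by simp
  qed
  then have "(\<Sum>\<tau>\<in>?D \<sigma> - {\<sigma>}. f \<tau>) = (\<Sum>\<tau>\<in>?D \<sigma> - {\<sigma>}. g \<tau>)"
    by (rule sum.cong[OF refl])
  then show ?case
    using eq[OF less.prems] unfolding sum.remove[OF fin self] by simp
qed

text \<open>The universal property of the join turns a bound on the join of a tuple into separate
  bounds on its entries; this lets the sum over tuples factor.\<close>

lemma NC_sup_refines_iff:
  assumes n: "n \<ge> 1" and A: "A \<subseteq> NC n" and \<sigma>: "\<sigma> \<in> NC n"
  shows "refines {1..n} (\<Squnion>\<^bsub>NC_lattice n\<^esub>A) \<sigma> \<longleftrightarrow> (\<forall>\<pi>\<in>A. refines {1..n} \<pi> \<sigma>)"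
proof -
  interpret complete_lattice "NC_lattice n"
    by (rule NC_complete_lattice[OF n])
  have carrier: "carrier (NC_lattice n) = NC n"
    and le: "\<And>\<pi> \<tau>. \<pi> \<sqsubseteq>\<^bsub>NC_lattice n\<^esub> \<tau> \<longleftrightarrow> refines {1..n} \<pi> \<tau>"
    by (simp_all add: NC_lattice_def)
  show ?thesis
    using sup_least[of A \<sigma>] sup_upper[of A] A \<sigma> refines_trans unfolding carrier le by blast
qed

lemma NC_sup_in_NC:
  assumes n: "n \<ge> 1" and A: "A \<subseteq> NC n"
  shows "\<Squnion>\<^bsub>NC_lattice n\<^esub>A \<in> NC n"
proof -
  interpret complete_lattice "NC_lattice n"
    by (rule NC_complete_lattice[OF n])
  show ?thesis
    using sup_closed[of A] A by (simp add: NC_lattice_def)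
qed

section \<open>The product formula for sequences, then for random variables\<close>

text \<open>The combinatorial core: independence enters only through the multiplicativity of
  moments, here a hypothesis on sequences over a commutative ring.\<close>

lemma free_cumulants_prod:
  fixes m :: "'i \<Rightarrow> nat \<Rightarrow> 'a::comm_ring_1" and \<mu> :: "nat \<Rightarrow> 'a"
  assumes I: "finite I" and n: "n \<ge> 1" and \<mu>: "\<And>l. \<mu> l = (\<Prod>i\<in>I. m i l)"
  shows "free_cumulants \<mu> n =
    (\<Sum>\<pi> | \<pi> \<in> I \<rightarrow>\<^sub>E NC n \<and> \<Squnion>\<^bsub>NC_lattice n\<^esub>(\<pi> ` I) = {{1..n}}.
       \<Prod>i\<in>I. block_prod (free_cumulants (m i)) (\<pi> i))"
proof -
  let ?w = "\<lambda>\<pi>. \<Prod>i\<in>I. block_prod (free_cumulants (m i)) (\<pi> i)"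
  let ?sup = "\<lambda>\<pi>. \<Squnion>\<^bsub>NC_lattice n\<^esub>(\<pi> ` I)"
  let ?D = "\<lambda>\<sigma>. {\<tau> \<in> NC n. refines {1..n} \<tau> \<sigma>}"
  define G where "G \<sigma> = (\<Sum>\<pi> | \<pi> \<in> I \<rightarrow>\<^sub>E NC n \<and> ?sup \<pi> = \<sigma>. ?w \<pi>)" for \<sigma>
  have fin: "finite (?D \<sigma>)" for \<sigma>
    using finite_NC[of n] by simp
  \<comment> \<open>At the one-block partition the left side is the cumulant of order
    \<open>n\<close>, and the right side is the sum over tuples with full join.\<close>
  have "block_prod (free_cumulants \<mu>) {{1..n}} = G {{1..n}}"
  proof (rule NC_sum_refines_inject[of n])
    fix \<sigma> assume \<sigma>: "\<sigma> \<in> NC n"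
    have sup: "?sup \<pi> \<in> NC n" "refines {1..n} (?sup \<pi>) \<sigma> \<longleftrightarrow> (\<forall>i\<in>I. refines {1..n} (\<pi> i) \<sigma>)"
      if "\<pi> \<in> I \<rightarrow>\<^sub>E NC n" for \<pi>
    proof -
      have sub: "\<pi> ` I \<subseteq> NC n"
        using that by auto
      show "?sup \<pi> \<in> NC n"
        by (rule NC_sup_in_NC[OF n sub])
      show "refines {1..n} (?sup \<pi>) \<sigma> \<longleftrightarrow> (\<forall>i\<in>I. refines {1..n} (\<pi> i) \<sigma>)"
        using NC_sup_refines_iff[OF n sub \<sigma>] by simp
    qed
    \<comment> \<open>A tuple whose join lies below \<sigma> has all its entries below
      \<sigma>.\<close>
    have "(\<Sum>\<tau>\<in>?D \<sigma>. G \<tau>) =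
        (\<Sum>\<tau>\<in>?D \<sigma>. \<Sum>\<pi> | \<pi> \<in> (I \<rightarrow>\<^sub>E ?D \<sigma>) \<and> ?sup \<pi> = \<tau>. ?w \<pi>)"
      unfolding G_def
    proof (intro sum.cong refl)
      fix \<tau> assume \<tau>: "\<tau> \<in> ?D \<sigma>"
      show "{\<pi>. \<pi> \<in> I \<rightarrow>\<^sub>E NC n \<and> ?sup \<pi> = \<tau>} = {\<pi>. \<pi> \<in> I \<rightarrow>\<^sub>E ?D \<sigma> \<and> ?sup \<pi> = \<tau>}"
        using \<tau> sup(2) by (auto simp: PiE_iff)
    qed
    \<comment> \<open>Conversely, entries below \<sigma> have their join below \<sigma>, so grouping
      by the join exhausts all such tuples.\<close>
    also have "\<dots> = (\<Sum>\<pi>\<in>I \<rightarrow>\<^sub>E ?D \<sigma>. ?w \<pi>)"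
    proof (rule sum.group)
      show "finite (I \<rightarrow>\<^sub>E ?D \<sigma>)"
        using I fin by (intro finite_PiE) auto
      show "?sup ` (I \<rightarrow>\<^sub>E ?D \<sigma>) \<subseteq> ?D \<sigma>"
        using sup by (auto simp: PiE_iff)
    qed (rule fin)
    also have "\<dots> = (\<Prod>i\<in>I. \<Sum>\<pi>\<in>?D \<sigma>. block_prod (free_cumulants (m i)) \<pi>)"
      using I fin by (intro prod_sum_PiE[symmetric])
    also have "\<dots> = (\<Prod>i\<in>I. block_prod (m i) \<sigma>)"
      by (intro prod.cong refl sum_refines_free_cumulants[OF \<sigma>])
    \<comment> \<open>The product over variables and the product over blocks are
      interchanged.\<close>
    also have "\<dots> = block_prod \<mu> \<sigma>"
      unfolding block_prod_def \<mu> by (rule prod.swap)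
    also have "\<dots> = (\<Sum>\<tau>\<in>?D \<sigma>. block_prod (free_cumulants \<mu>) \<tau>)"
      by (rule sum_refines_free_cumulants[OF \<sigma>, symmetric])
    finally show "(\<Sum>\<tau>\<in>?D \<sigma>. block_prod (free_cumulants \<mu>) \<tau>) = (\<Sum>\<tau>\<in>?D \<sigma>. G \<tau>)" ..
  qed (rule one_block_in_NC[OF n])
  then show ?thesis
    by (simp add: block_prod_def G_def)
qed

text \<open>Powers of independent variables are again independent, and the power of a product is the
  product of the powers.\<close>

lemma (in prob_space) moment_prod_indep:
  fixes X :: "'i \<Rightarrow> 'a \<Rightarrow> 'b::{real_normed_field, banach, second_countable_topology}"
  assumes I: "finite I"
    and indep: "indep_vars (\<lambda>_. borel) X I"
    and moments: "\<And>i. i \<in> I \<Longrightarrow> has_all_moments M (X i)"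
  shows "moment M (\<lambda>\<omega>. \<Prod>i\<in>I. X i \<omega>) n = (\<Prod>i\<in>I. moment M (X i) n)"
proof -
  have "indep_vars (\<lambda>_. borel) (\<lambda>i \<omega>. X i \<omega> ^ n) I"
    by (rule indep_vars_compose2[OF indep]) simp
  then have "(\<integral>\<omega>. (\<Prod>i\<in>I. X i \<omega> ^ n) \<partial>M) = (\<Prod>i\<in>I. \<integral>\<omega>. X i \<omega> ^ n \<partial>M)"
    using I moments by (intro indep_vars_lebesgue_integral) (auto simp: has_all_moments_def)
  then show ?thesis
    by (simp add: moment_def prod_power_distrib)
qed

theorem theorem1p2:
  fixes M :: "'w measure"
    and X :: "nat \<Rightarrow> 'w \<Rightarrow> 'a::{real_normed_field, banach, second_countable_topology}"
    and k n :: nat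
  assumes "prob_space M"
    and "k \<ge> 1"
    and "prob_space.indep_vars M (\<lambda>_. borel) X {1..k}"
    and "\<And>i. i \<in> {1..k} \<Longrightarrow> has_all_moments M (X i)"
    and "n \<ge> 1"
  shows "free_cumulants (moment M (\<lambda>\<omega>. \<Prod>i\<in>{1..k}. X i \<omega>)) n =
    (\<Sum>\<pi> | \<pi> \<in> {1..k} \<rightarrow>\<^sub>E NC n \<and> \<Squnion>\<^bsub>NC_lattice n\<^esub>(\<pi> ` {1..k}) = {{1..n}}.
       \<Prod>i\<in>{1..k}. block_prod (free_cumulants (moment M (X i))) (\<pi> i))"
proof -
  interpret prob_space M by fact
  show ?thesis
    using assms by (intro free_cumulants_prod moment_prod_indep) auto
qed

end
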